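(* For every positive integer $H$, $$\mathcal{G}(H)=2\log H+2\log2+2\gamma+O\left(\frac1H\right),$$ where $\gamma$ is the Euler–Mascheroni constant.
   Context: $e(z)=\exp(2\pi i z)$ and $$\mathcal{G}(H)=\max_{\alpha\in[0,1)}\ \max_{(y_{-H},\dots,y_{-1},y_1,\dots,y_H)\in[-1,1]^{2H}}\left|\sum_{1\le|h|\le H}\frac{e(\alpha h)-1}{h}y_h\right|.$$ *)

theory Defs
  imports "HOL-Analysis.Analysis"
begin

definition e :: "real \<Rightarrow> complex" where
  "e z = exp (2 * of_real pi * \<i> * of_real z)"

definition idx :: "nat \<Rightarrow> int set" where
  "idx H = {h. 1 \<le> \<bar>h\<bar> \<and> \<bar>h\<bar> \<le> int H}"

definition trig_sum :: "nat \<Rightarrow> real \<Rightarrow> (int \<Rightarrow> real) \<Rightarrow> complex" where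
  "trig_sum H \<alpha> y = (\<Sum>h\<in>idx H. (e (\<alpha> * of_int h) - 1) / of_int h * of_real (y h))"

text \<open>The vector \<open>y\<close> is a function on the integers of which only the values on
  \<^term>\<open>idx H\<close> matter. The maxima are written as suprema; the lemma \<open>G_is_max\<close> below
  shows that they are attained.\<close>

definition G :: "nat \<Rightarrow> real" where
  "G H = (SUP \<alpha>\<in>{0..<1}. SUP y\<in>idx H \<rightarrow> {-1..1}. cmod (trig_sum H \<alpha> y))"

lemma finite_idx: "finite (idx H)"
proof (rule finite_subset)
  show "idx H \<subseteq> {- int H..int H}" by (auto simp: idx_def)
qed simp

lemma trig_sum_attains_max:
  obtains \<alpha> y where "\<alpha> \<in> {0..<1}" "y \<in> idx H \<rightarrow> {-1..1}"
    "\<And>\<beta> z. \<beta> \<in> {0..<1} \<Longrightarrow> z \<in> idx H \<rightarrow> {-1..1} \<Longrightarrow>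
       cmod (trig_sum H \<beta> z) \<le> cmod (trig_sum H \<alpha> y)"
proof -
  define Y :: "(int \<Rightarrow> real) set"
    where "Y = Pi\<^sub>E UNIV (\<lambda>h. if h \<in> idx H then {-1..1} else {0})"
  have "compactin (product_topology (\<lambda>_. euclidean) UNIV) Y"
    unfolding Y_def compactin_PiE by auto
  then have "compact Y"
    by (simp add: euclidean_product_topology)
  then have K: "compact ({0..1::real} \<times> Y)"
    by (intro compact_Times) auto
  have zero: "(\<lambda>_. 0) \<in> Y" by (auto simp: Y_def PiE_def)
  have ne: "{0..1::real} \<times> Y \<noteq> {}" using zero by (auto intro!: exI[of _ 0])
  have [continuous_intros]: "continuous_on A (\<lambda>p. snd p h)" for h and A :: "(real \<times> (int \<Rightarrow> real)) set"
    by (rule continuous_on_product_then_coordinatewise) (intro continuous_intros)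
  have cont: "continuous_on ({0..1} \<times> Y) (\<lambda>p. cmod (trig_sum H (fst p) (snd p)))"
    unfolding trig_sum_def e_def
    by (intro continuous_intros) (auto simp: idx_def)
  obtain p where p: "p \<in> {0..1} \<times> Y"
    and pmax: "\<And>q. q \<in> {0..1} \<times> Y \<Longrightarrow>
      cmod (trig_sum H (fst q) (snd q)) \<le> cmod (trig_sum H (fst p) (snd p))"
    using continuous_attains_sup[OF K ne cont] by blast
  define a where "a = (if fst p = 1 then 0 else fst p)"
  have "e (1 * of_int h) = e (0 * of_int h)" for h
  proof -
    have "e (of_int h) = exp (2 * of_int h * pi * \<i>)" by (simp add: e_def mult_ac)
    also have "\<dots> = 1" by (rule exp_integer_2pi) auto
    finally show ?thesis by (simp add: e_def)
  qed
  then have eq: "trig_sum H a (snd p) = trig_sum H (fst p) (snd p)"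
    by (auto simp: a_def trig_sum_def)
  show thesis
  proof (rule that[of a "snd p"])
    show "a \<in> {0..<1}" using p by (auto simp: a_def less_le)
    show "snd p \<in> idx H \<rightarrow> {-1..1}"
    proof
      fix h assume h: "h \<in> idx H"
      have "snd p h \<in> (if h \<in> idx H then {-1..1} else {0})"
        using p unfolding Y_def by (auto simp: PiE_def Pi_def split del: if_split)
      with h show "snd p h \<in> {-1..1}" by simp
    qed
    fix \<beta> :: real and z :: "int \<Rightarrow> real"
    assume b: "\<beta> \<in> {0..<1}" and z: "z \<in> idx H \<rightarrow> {-1..1}"
    define z' where "z' h = (if h \<in> idx H then z h else 0)" for h
    have "z' \<in> Y" using z by (auto simp: Y_def z'_def PiE_def Pi_def)
    moreover have "trig_sum H \<beta> z' = trig_sum H \<beta> z"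
      by (simp add: trig_sum_def z'_def)
    ultimately show "cmod (trig_sum H \<beta> z) \<le> cmod (trig_sum H a (snd p))"
      using pmax[of "(\<beta>, z')"] b eq by simp
  qed
qed

lemma G_is_max:
  obtains \<alpha> y where "\<alpha> \<in> {0..<1}" "y \<in> idx H \<rightarrow> {-1..1}"
    "G H = cmod (trig_sum H \<alpha> y)"
    "\<And>\<beta> z. \<beta> \<in> {0..<1} \<Longrightarrow> z \<in> idx H \<rightarrow> {-1..1} \<Longrightarrow> cmod (trig_sum H \<beta> z) \<le> G H"
proof -
  obtain \<alpha> y where a: "\<alpha> \<in> {0..<1}" and y: "y \<in> idx H \<rightarrow> {-1..1}"
    and m: "\<And>\<beta> z. \<beta> \<in> {0..<1} \<Longrightarrow> z \<in> idx H \<rightarrow> {-1..1} \<Longrightarrow>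
       cmod (trig_sum H \<beta> z) \<le> cmod (trig_sum H \<alpha> y)"
    using trig_sum_attains_max by blast
  let ?S = "\<lambda>\<beta>. SUP z\<in>idx H \<rightarrow> {-1..1}. cmod (trig_sum H \<beta> z)"
  have S: "?S \<beta> \<le> cmod (trig_sum H \<alpha> y)" if "\<beta> \<in> {0..<1}" for \<beta>
    using y m that by (intro cSUP_least) auto
  have "cmod (trig_sum H \<alpha> y) \<le> ?S \<alpha>"
    using y by (rule cSUP_upper) (rule bdd_aboveI2, rule m[OF a])
  also have "?S \<alpha> \<le> G H"
    unfolding G_def using a by (rule cSUP_upper) (rule bdd_aboveI2, rule S)
  finally have "cmod (trig_sum H \<alpha> y) \<le> G H" .
  moreover have "G H \<le> cmod (trig_sum H \<alpha> y)"
    unfolding G_def by (rule cSUP_least) (use S in auto)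
  ultimately have "G H = cmod (trig_sum H \<alpha> y)" by simp
  with a y m show thesis by (intro that) auto
qed

end

theory Submission
  imports Defs
begin

text \<open>
  Pair the indices \<open>h\<close> and \<open>-h\<close> and rotate the sum onto the positive real axis by a unit
  \<open>c + is\<close>. With \<open>t = 2\<pi>\<alpha>h\<close>, the \<open>h\<close>-th pair then contributes at most
  \<open>2/h\<close> times the larger of \<open>\<bar>c\<bar>(1 - cos t)\<close> and \<open>\<bar>s\<bar>\<bar>sin t\<bar>\<close>, and both are bounded by
  \<open>1 - a cos t\<close> for one \<open>a \<in> [0,1]\<close> that does not depend on \<open>t\<close>. So the upper bound reduces to
  \<open>\<Sum>h\<le>H. cos (h\<theta>) / h \<ge> - ln 2 - O(1/H)\<close> uniformly in \<open>\<theta>\<close>. The choice \<open>\<alpha> = 1/2\<close>,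
  \<open>y h = - sgn h\<close> gives the matching lower bound.
\<close>

section \<open>A uniform lower bound for the cosine sums\<close>

definition cos_sum :: "nat \<Rightarrow> real \<Rightarrow> real" where
  "cos_sum H \<theta> = (\<Sum>h=1..H. cos (real h * \<theta>) / real h)"

text \<open>Product-to-sum turns the \<open>h\<close>-th term into
  \<open>cos ((h - 1/2) * t) - cos ((h + 1/2) * t)\<close>, which telescopes. This gives the
  derivative of \<open>cos_sum H\<close> in closed form.\<close>

lemma sum_sin_mult_sin_half:
  "2 * sin (t/2) * (\<Sum>h=1..H. sin (real h * t)) = cos (t/2) - cos ((real H + 1/2) * t)"
proof (induction H)
  case (Suc H)
  have "2 * sin (t/2) * sin (real (Suc H) * t) =
      cos (t/2 - real (Suc H) * t) - cos (t/2 + real (Suc H) * t)"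
    by (simp only: cos_diff cos_add)
  also have "cos (t/2 - real (Suc H) * t) = cos ((real H + 1/2) * t)"
    by (subst cos_minus[symmetric]) (simp add: algebra_simps)
  also have "t/2 + real (Suc H) * t = (real (Suc H) + 1/2) * t"
    by (simp add: algebra_simps)
  finally show ?case using Suc by (simp add: distrib_left)
qed simp

lemma cos_sum_has_derivative:
  assumes "sin (t/2) \<noteq> 0"
  shows "(cos_sum H has_real_derivative
    - (cos (t/2) - cos ((real H + 1/2) * t)) / (2 * sin (t/2))) (at t)"
proof -
  have "(cos_sum H has_real_derivative (\<Sum>h=1..H. - sin (real h * t))) (at t)"
    unfolding cos_sum_def
    by (rule DERIV_sum) (auto intro!: derivative_eq_intros)
  moreover have "(\<Sum>h=1..H. - sin (real h * t)) =
      - (cos (t/2) - cos ((real H + 1/2) * t)) / (2 * sin (t/2))"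
    using sum_sin_mult_sin_half[of t H] assms by (simp add: sum_negf field_simps)
  ultimately show ?thesis by simp
qed

text \<open>The function \<open>F\<close> below replaces an integration by parts of
  \<open>cos ((H + 1/2) t) / (2 sin (t/2))\<close>: it is nonincreasing on \<open>(0, \<pi>]\<close>.\<close>

lemma cos_sum_ge_cos_sum_pi:
  assumes "0 < \<theta>" "\<theta> \<le> pi"
  shows "cos_sum H \<theta> \<ge> cos_sum H pi - ln (sin (\<theta>/2)) - 1 / ((real H + 1/2) * sin (\<theta>/2))"
proof -
  define N where "N = real H + 1/2"
  have N: "N > 0" by (simp add: N_def)
  \<comment> \<open>The logarithm cancels the \<open>cos (t/2)\<close> part of the derivative, and
    the last summand cancels the oscillating part \<open>cos (N*t) / (2 * sin (t/2))\<close>. Having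
    \<open>1 - sin (N*t)\<close> there instead of \<open>- sin (N*t)\<close> gives the remainder a
    fixed sign.\<close>
  define F where "F t = cos_sum H t + ln (sin (t/2)) + (1 - sin (N*t)) / (2 * N * sin (t/2))" for t
  have "F pi \<le> F \<theta>"
  proof (rule DERIV_nonpos_imp_nonincreasing[OF assms(2)])
    fix t assume t: "\<theta> \<le> t" "t \<le> pi"
    have s: "sin (t/2) > 0" using t assms by (intro sin_gt_zero) auto
    have c: "cos (t/2) \<ge> 0" using t assms by (intro cos_ge_zero) auto
    have "(F has_real_derivative
        - (cos (t/2) - cos (N*t)) / (2 * sin (t/2)) + cos (t/2) / (2 * sin (t/2))
        + (- (N * cos (N*t)) * (2 * N * sin (t/2)) - (1 - sin (N*t)) * (N * cos (t/2)))
            / (2 * N * sin (t/2))\<^sup>2) (at t)"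
      unfolding F_def using s N
      by (auto intro!: derivative_eq_intros cos_sum_has_derivative[of t H, folded N_def]
          simp: power2_eq_square field_simps)
    moreover have "- (cos (t/2) - cos (N*t)) / (2 * sin (t/2)) + cos (t/2) / (2 * sin (t/2))
        + (- (N * cos (N*t)) * (2 * N * sin (t/2)) - (1 - sin (N*t)) * (N * cos (t/2)))
            / (2 * N * sin (t/2))\<^sup>2
        = - ((1 - sin (N*t)) * cos (t/2) / (4 * N * (sin (t/2))\<^sup>2))"
      using s N by (simp add: power2_eq_square field_simps)
    moreover have "(1 - sin (N*t)) * cos (t/2) / (4 * N * (sin (t/2))\<^sup>2) \<ge> 0"
      using c N s by (intro divide_nonneg_pos mult_nonneg_nonneg) auto
    ultimately show "\<exists>y. (F has_real_derivative y) (at t) \<and> y \<le> 0" by force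
  qed
  moreover have "F pi \<ge> cos_sum H pi" using N by (simp add: F_def)
  moreover have "(1 - sin (N*\<theta>)) / (2 * N * sin (\<theta>/2)) \<le> 2 / (2 * N * sin (\<theta>/2))"
  proof (rule divide_right_mono)
    show "1 - sin (N*\<theta>) \<le> 2" using sin_ge_minus_one[of "N*\<theta>"] by linarith
    have "sin (\<theta>/2) > 0" using assms by (intro sin_gt_zero) auto
    then show "0 \<le> 2 * N * sin (\<theta>/2)" using N by simp
  qed
  moreover have "2 / (2 * N * sin (\<theta>/2)) = 1 / ((real H + 1/2) * sin (\<theta>/2))"
    by (simp only: N_def mult.assoc) simp
  ultimately show ?thesis unfolding F_def by linarith
qed

lemma cos_sum_pi: "cos_sum H pi = - (\<Sum>k<H. (-1)^k * (1 / real (Suc k)))"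
proof -
  have "cos_sum H pi = (\<Sum>k<H. cos (real (Suc k) * pi) / real (Suc k))"
    unfolding cos_sum_def by (rule sum.reindex_bij_witness[of _ Suc "\<lambda>h. h - 1"]) auto
  also have "\<dots> = (\<Sum>k<H. - ((-1)^k * (1 / real (Suc k))))"
    by (intro sum.cong) (simp_all only: cos_npi, simp_all)
  finally show ?thesis by (simp add: sum_negf)
qed

text \<open>Consecutive partial sums of the alternating harmonic series enclose \<open>ln 2\<close>,
  so the error is at most one term: the next one for even \<open>H\<close>, the last one for odd
  \<open>H\<close>.\<close>

lemma cos_sum_pi_approx:
  assumes "H \<ge> 1"
  shows "\<bar>cos_sum H pi + ln 2\<bar> \<le> 1 / real H"
proof -
  let ?a = "\<lambda>k. 1 / real (Suc k)" and ?S = "\<lambda>n. \<Sum>k<n. (-1)^k * (1 / real (Suc k))"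
  have lim: "?a \<longlonglongrightarrow> 0" using LIMSEQ_inverse_real_of_nat by (simp add: inverse_eq_divide)
  have mono: "?a (Suc n) \<le> ?a n" for n by (simp add: field_simps)
  have suminf: "(\<Sum>k. (-1)^k * ?a k) = ln 2"
    using alternating_harmonic_series_sums by (simp add: sums_iff)
  have lo: "?S (2*n) \<le> ln 2" and up: "ln 2 \<le> ?S (2*n+1)" for n
    using summable_Leibniz'(2,4)[of ?a n, OF lim _ mono] suminf by simp_all
  have "\<bar>ln 2 - ?S H\<bar> \<le> 1 / real H"
  proof (cases "even H")
    case True
    then obtain n where n: "H = 2 * n" by blast
    have "?S (2*n+1) = ?S (2*n) + 1 / real (2*n+1)" by simp
    moreover have "1 / real (2*n+1) \<le> 1 / real H" using n assms by (simp add: field_simps)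
    ultimately show ?thesis using lo[of n] up[of n] unfolding n abs_le_iff by linarith
  next
    case False
    then obtain n where n: "H = 2 * n + 1" using oddE by blast
    have "?S (2*n+1) = ?S (2*n) + 1 / real H" using n by simp
    then show ?thesis using lo[of n] up[of n] unfolding n abs_le_iff by linarith
  qed
  then show ?thesis by (simp add: cos_sum_pi abs_le_iff)
qed

lemma sin_ge_half_self:
  assumes "0 \<le> x" "x \<le> pi/2"
  shows "sin x \<ge> x/2"
proof (cases "x \<le> pi/3")
  case True
  have "sin 0 - 0/2 \<le> sin x - x/2"
  proof (rule DERIV_nonneg_imp_nondecreasing[OF assms(1)])
    fix t assume t: "0 \<le> t" "t \<le> x"
    have "cos (pi/3) \<le> cos t" using t True by (intro cos_monotone_0_pi_le) auto
    moreover have "((\<lambda>t. sin t - t/2) has_real_derivative cos t - 1/2) (at t)"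
      by (auto intro!: derivative_eq_intros)
    ultimately show "\<exists>y. ((\<lambda>t. sin t - t/2) has_real_derivative y) (at t) \<and> y \<ge> 0"
      by (intro exI[of _ "cos t - 1/2"]) (simp add: cos_60)
  qed
  then show ?thesis by simp
next
  case False
  \<comment> \<open>Beyond \<open>pi/3\<close> the sine is at least
    \<open>sqrt 3 / 2 \<ge> 0.85\<close>, while \<open>x/2 \<le> pi/4 < 0.79\<close>.\<close>
  have "sqrt 3 \<ge> 1.7" by (rule real_le_rsqrt) (simp add: power2_eq_square)
  moreover have "sin (pi/3) \<le> sin x" using False assms by (intro sin_monotone_2pi_le) auto
  ultimately show ?thesis using assms pi_less_4 pi_approx by (simp add: sin_60)
qed

text \<open>The error term of \<open>cos_sum_ge_cos_sum_pi\<close> blows up as \<theta> tends to 0.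
  For \<open>H * \<theta> \<le> pi/2\<close> all summands are nonnegative; otherwise
  \<open>H * \<sigma> \<ge> 1/4\<close> for \<open>\<sigma> = sin (\<theta>/2)\<close>, which keeps
  the error term at most 4.\<close>

lemma cos_sum_ge_0_pi:
  assumes "H \<ge> 1" "0 \<le> \<theta>" "\<theta> \<le> pi"
  shows "cos_sum H \<theta> \<ge> - ln 2 - (exp 4 + 1) / real H"
proof (cases "real H * \<theta> \<le> pi/2")
  case True
  have "cos_sum H \<theta> \<ge> 0" unfolding cos_sum_def
  proof (intro sum_nonneg divide_nonneg_nonneg cos_ge_zero)
    fix h assume "h \<in> {1..H}"
    then have "real h * \<theta> \<le> real H * \<theta>" using assms by (intro mult_right_mono) auto
    then show "real h * \<theta> \<le> pi/2" using True by simp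
    have "0 \<le> real h * \<theta>" using assms by simp
    then show "- (pi/2) \<le> real h * \<theta>" using pi_gt_zero by linarith
  qed auto
  moreover have "(exp 4 + 1) / real H \<ge> 0" by simp
  moreover have "ln 2 \<ge> (0::real)" by simp
  ultimately show ?thesis by linarith
next
  case False
  define \<sigma> where "\<sigma> = sin (\<theta>/2)"
  have \<theta>: "\<theta> > 0" using False assms pi_gt_zero by (cases "\<theta> = 0") auto
  have H: "real H > 0" using assms by simp
  have "\<sigma> \<ge> \<theta>/4" using sin_ge_half_self[of "\<theta>/2"] assms by (simp add: \<sigma>_def)
  then have "real H * \<sigma> \<ge> real H * (\<theta>/4)" using H by (intro mult_left_mono) auto
  then have H\<sigma>: "real H * \<sigma> \<ge> 1/4" using False pi_gt3 by simp
  have \<sigma>: "\<sigma> > 0" using \<theta> assms unfolding \<sigma>_def by (intro sin_gt_zero) auto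
  have "1 / ((real H + 1/2) * \<sigma>) \<le> 1 / (real H * \<sigma>)"
    using H \<sigma> by (intro divide_left_mono mult_right_mono) auto
  then have lower: "cos_sum H \<theta> \<ge> cos_sum H pi - ln \<sigma> - 1 / (real H * \<sigma>)"
    using cos_sum_ge_cos_sum_pi[OF \<theta> assms(3), of H] by (simp add: \<sigma>_def)
  have "- ln \<sigma> - 1 / (real H * \<sigma>) \<ge> - exp 4 / real H"
  \<comment> \<open>Below the threshold \<open>exp (-4)\<close>, \<open>- ln \<sigma>\<close>
    exceeds 4 and absorbs the error term; above it, the error term is at most
    \<open>exp 4 / H\<close>.\<close>
  proof (cases "\<sigma> \<ge> exp (-4)")
    case True
    have "1 / \<sigma> \<le> 1 / exp (-4)" using True \<sigma> by (intro divide_left_mono) auto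
    then have "(1 / \<sigma>) / real H \<le> exp 4 / real H"
      using H by (intro divide_right_mono) (auto simp: exp_minus field_simps)
    moreover have "ln \<sigma> \<le> 0" using \<sigma> by (simp add: \<sigma>_def)
    ultimately show ?thesis by (simp add: mult.commute)
  next
    case False
    then have "ln \<sigma> \<le> ln (exp (-4))" using \<sigma> by (subst ln_le_cancel_iff) auto
    moreover have "1 / (real H * \<sigma>) \<le> 4" using H\<sigma> H \<sigma> by (simp add: field_simps)
    moreover have "- exp 4 / real H \<le> 0" by simp
    moreover have "ln (exp (-4)) = (-4 :: real)" by (rule ln_exp)
    ultimately show ?thesis by linarith
  qed
  then show ?thesis
    using lower cos_sum_pi_approx[OF assms(1)] by (simp add: add_divide_distrib abs_le_iff)
qed

lemma cos_sum_ge: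
  assumes "H \<ge> 1" "0 \<le> \<theta>" "\<theta> \<le> 2 * pi"
  shows "cos_sum H \<theta> \<ge> - ln 2 - (exp 4 + 1) / real H"
proof (cases "\<theta> \<le> pi")
  case False
  have "cos (real h * (2 * pi - \<theta>)) = cos (real h * \<theta>)" for h :: nat
  proof -
    have "cos (real h * (2 * pi - \<theta>)) = cos (2 * pi * real h - real h * \<theta>)"
      by (simp add: algebra_simps)
    then show ?thesis by (simp add: cos_diff cos_integer_2pi sin_integer_2pi)
  qed
  then have "cos_sum H (2 * pi - \<theta>) = cos_sum H \<theta>" by (simp add: cos_sum_def)
  then show ?thesis using cos_sum_ge_0_pi[OF assms(1), of "2 * pi - \<theta>"] assms False by simp
qed (use cos_sum_ge_0_pi assms in auto)

section \<open>A common majorant for the real and imaginary parts\<close>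

lemma four_mult_le_square_sum: "4 * x * y \<le> (x + y)\<^sup>2" for x y :: real
  using zero_le_power2[of "x - y"] by (simp only: power2_sum power2_diff)

text \<open>For \<open>s \<le> 2 c\<close> the majorant is \<open>c (1 - cos t) + s\<^sup>2/(4 c) (1 + cos t)\<close>, which dominates
  \<open>s \<bar>sin t\<bar>\<close> by AM-GM and has mean value \<open>c + (1 - c\<^sup>2)/(4 c) \<le> 1\<close>.\<close>

lemma trig_majorant:
  fixes c s :: real
  assumes "c \<ge> 0" "s \<ge> 0" "c\<^sup>2 + s\<^sup>2 = 1"
  obtains a where "0 \<le> a" "a \<le> 1"
    "\<And>t. c * (1 - cos t) \<le> 1 - a * cos t" "\<And>t. s * \<bar>sin t\<bar> \<le> 1 - a * cos t"
proof (cases "s \<le> 2 * c")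
  case False
  have "s\<^sup>2 \<le> 1" using assms(3) zero_le_power2[of c] by linarith
  then have s1: "s \<le> 1" using assms(2) by (simp add: power_le_one_iff abs_square_le_1)
  show thesis
  \<comment> \<open>Here \<open>2 * c < s \<le> 1\<close>, so the constant 1 already dominates both
    functions.\<close>
  proof (rule that[of 0])
    fix t
    have "c * (1 - cos t) \<le> c * 2"
      using assms cos_ge_minus_one[of t] by (intro mult_left_mono) linarith+
    then show "c * (1 - cos t) \<le> 1 - 0 * cos t" using False s1 by simp
    show "s * \<bar>sin t\<bar> \<le> 1 - 0 * cos t" using mult_le_one[OF s1, of "\<bar>sin t\<bar>"] by simp
  qed auto
next
  case True
  define r where "r = s\<^sup>2 / (4 * c)"
  have "c \<noteq> 0" using True assms by auto
  then have c: "c > 0" using assms by simp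
  have "s\<^sup>2 \<le> (2 * c)\<^sup>2" using True assms by (intro power_mono) auto
  then have s2: "s\<^sup>2 \<le> 4 * c\<^sup>2" by (simp add: power_mult_distrib)
  \<comment> \<open>From \<open>s \<le> 2 * c\<close> one gets \<open>5 * c\<^sup>2 \<ge> 1\<close>;
    the weaker \<open>c \<ge> 1/3\<close> is exactly what \<open>mean\<close> needs.\<close>
  have "c\<^sup>2 \<ge> (1/3)\<^sup>2" using s2 assms(3) by (simp add: power2_eq_square)
  then have c3: "c \<ge> 1/3" using c by (intro power2_le_imp_le[of "1/3" c]) auto
  have "c\<^sup>2 \<le> 1" using assms(3) zero_le_power2[of s] by linarith
  then have c1: "c \<le> 1" using c by (simp add: power_le_one_iff abs_square_le_1)
  have r0: "r \<ge> 0" using c by (simp add: r_def)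
  have rc: "r \<le> c" using s2 c by (simp add: r_def field_simps power2_eq_square)
  \<comment> \<open>With \<open>s\<^sup>2 = 1 - c\<^sup>2\<close>, multiplying
    \<open>c + r \<le> 1\<close> by \<open>4 * c\<close> turns it into this inequality.\<close>
  have "(1 - c) * (3 * c - 1) \<ge> 0" using c1 c3 by (intro mult_nonneg_nonneg) auto
  then have mean: "c + r \<le> 1"
    using c assms(3) by (simp add: r_def field_simps power2_eq_square)
  have bound: "c * (1 - cos t) + r * (1 + cos t) \<le> 1 - (c - r) * cos t" for t
    using mean by (simp add: algebra_simps)
  show thesis
  proof (rule that[of "c - r"])
    fix t :: real
    have p: "1 + cos t \<ge> 0" "1 - cos t \<ge> 0" using cos_ge_minus_one[of t] by (linarith, simp)
    then have "c * (1 - cos t) \<le> c * (1 - cos t) + r * (1 + cos t)" using r0 by simp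
    then show "c * (1 - cos t) \<le> 1 - (c - r) * cos t" using bound[of t] by linarith
    have "(s * \<bar>sin t\<bar>)\<^sup>2 = 4 * (c * (1 - cos t)) * (r * (1 + cos t))"
    proof -
      have "(sin t)\<^sup>2 = (1 - cos t) * (1 + cos t)"
        by (simp add: sin_squared_eq power2_eq_square algebra_simps)
      then show ?thesis using c by (simp add: r_def power_mult_distrib)
    qed
    also have "\<dots> \<le> (c * (1 - cos t) + r * (1 + cos t))\<^sup>2"
      by (rule four_mult_le_square_sum)
    finally have "s * \<bar>sin t\<bar> \<le> c * (1 - cos t) + r * (1 + cos t)"
      by (rule power2_le_imp_le) (use p c r0 in simp)
    then show "s * \<bar>sin t\<bar> \<le> 1 - (c - r) * cos t" using bound[of t] by linarith
  qed (use rc r0 c1 in auto)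
qed

section \<open>Pairing opposite indices and bounding the sum\<close>

lemma e_eq_cis: "e x = cis (2 * pi * x)"
  by (simp add: e_def cis_conv_exp mult_ac)

text \<open>Passing from \<open>h\<close> to \<open>-h\<close> conjugates \<open>e\<close> and flips
  the sign of the denominator. Hence real parts see only the difference of the two values of
  \<open>y\<close>, imaginary parts only their sum.\<close>

lemma trig_sum_eq:
  "trig_sum H \<alpha> y = (\<Sum>h=1..H. Complex
     ((1 - cos (real h * (2 * pi * \<alpha>))) / real h * (y (- int h) - y (int h)))
     (sin (real h * (2 * pi * \<alpha>)) / real h * (y (int h) + y (- int h))))"
proof -
  let ?f = "\<lambda>h. (e (\<alpha> * of_int h) - 1) / of_int h * of_real (y h)"
  have idx: "idx H = int ` {1..H} \<union> (\<lambda>h. - int h) ` {1..H}"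
  proof (intro set_eqI iffI)
    fix h assume h: "h \<in> idx H"
    show "h \<in> int ` {1..H} \<union> (\<lambda>h. - int h) ` {1..H}"
    proof (cases "h \<ge> 0")
      case True
      then have "h = int (nat h)" "nat h \<in> {1..H}" using h by (auto simp: idx_def)
      then show ?thesis by blast
    next
      case False
      then have "h = - int (nat (-h))" "nat (-h) \<in> {1..H}" using h by (auto simp: idx_def)
      then show ?thesis by blast
    qed
  qed (auto simp: idx_def)
  have "trig_sum H \<alpha> y = sum ?f (int ` {1..H}) + sum ?f ((\<lambda>h. - int h) ` {1..H})"
    unfolding trig_sum_def idx by (rule sum.union_disjoint) auto
  also have "sum ?f (int ` {1..H}) = (\<Sum>h=1..H. ?f (int h))"
    by (subst sum.reindex) (auto simp: inj_on_def)
  also have "sum ?f ((\<lambda>h. - int h) ` {1..H}) = (\<Sum>h=1..H. ?f (- int h))"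
    by (subst sum.reindex) (auto simp: inj_on_def)
  finally have "trig_sum H \<alpha> y = (\<Sum>h=1..H. ?f (int h) + ?f (- int h))"
    by (simp only: sum.distrib)
  also have "\<dots> = (\<Sum>h=1..H. Complex
     ((1 - cos (real h * (2 * pi * \<alpha>))) / real h * (y (- int h) - y (int h)))
     (sin (real h * (2 * pi * \<alpha>)) / real h * (y (int h) + y (- int h))))"
  proof (rule sum.cong)
    fix h assume "h \<in> {1..H}"
    then have "h \<noteq> 0" by simp
    then show "?f (int h) + ?f (- int h) = Complex
     ((1 - cos (real h * (2 * pi * \<alpha>))) / real h * (y (- int h) - y (int h)))
     (sin (real h * (2 * pi * \<alpha>)) / real h * (y (int h) + y (- int h)))"
      by (simp add: complex_eq_iff e_eq_cis Re_divide_of_nat Im_divide_of_nat field_simps)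
  qed simp
  finally show ?thesis .
qed

text \<open>With \<open>a\<close> from \<open>trig_majorant\<close> this evaluates the upper bound,
  with \<open>a = 1\<close> the extremal sum.\<close>

lemma sum_one_minus_cos:
  "(\<Sum>h=1..H. 2 / real h * (1 - a * cos (real h * \<theta>))) = 2 * harm H - 2 * a * cos_sum H \<theta>"
  by (simp add: harm_def cos_sum_def sum_distrib_left sum_subtractf right_diff_distrib
      inverse_eq_divide mult_ac)

lemma cmod_trig_sum_le:
  assumes "H \<ge> 1" "\<alpha> \<in> {0..<1}" "y \<in> idx H \<rightarrow> {-1..1}"
  shows "cmod (trig_sum H \<alpha> y) \<le> 2 * harm H + 2 * ln 2 + 2 * (exp 4 + 1) / real H"
proof -
  define z where "z = trig_sum H \<alpha> y"
  define \<theta> where "\<theta> = 2 * pi * \<alpha>"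
  obtain u where u: "cmod u = 1" "Re (u * z) = cmod z"
  proof (cases "z = 0")
    case False
    show thesis
    proof (rule that[of "cnj (sgn z)"])
      have "cnj (sgn z) * z = of_real (cmod z)"
        using False by (simp add: sgn_eq field_simps complex_norm_square[symmetric] power2_eq_square)
      then show "Re (cnj (sgn z) * z) = cmod z" by simp
    qed (use False in \<open>simp add: norm_sgn\<close>)
  qed (use that[of 1] in simp)
  define c s where "c = \<bar>Re u\<bar>" and "s = \<bar>Im u\<bar>"
  have "c\<^sup>2 + s\<^sup>2 = 1" using u(1) by (simp add: c_def s_def cmod_def)
  then obtain a where a: "0 \<le> a" "a \<le> 1"
    "\<And>t. c * (1 - cos t) \<le> 1 - a * cos t" "\<And>t. s * \<bar>sin t\<bar> \<le> 1 - a * cos t"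
    using trig_majorant[of c s] by (auto simp: c_def s_def)
  have "cmod z = (\<Sum>h=1..H.
      Re u * ((1 - cos (real h * \<theta>)) / real h * (y (- int h) - y (int h)))
      - Im u * (sin (real h * \<theta>) / real h * (y (int h) + y (- int h))))"
    by (subst u(2)[symmetric])
      (simp add: z_def trig_sum_eq \<theta>_def sum_distrib_left sum_subtractf)
  also have "\<dots> \<le> (\<Sum>h=1..H. 2 / real h * (1 - a * cos (real h * \<theta>)))"
  proof (rule sum_mono)
    fix h assume h: "h \<in> {1..H}"
    let ?t = "real h * \<theta>" and ?v = "y (- int h)" and ?w = "y (int h)"
    let ?M = "1 - a * cos ?t"
    have "int h \<in> idx H" "- int h \<in> idx H" using h by (auto simp: idx_def)
    then have "?v \<in> {-1..1}" "?w \<in> {-1..1}" using assms(3) by blast+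
    \<comment> \<open>The left side equals twice the larger of \<open>\<bar>?v\<bar>\<close> and
      \<open>\<bar>?w\<bar>\<close>, so a common majorant of both coefficients costs only a factor
      2.\<close>
    then have vw: "\<bar>?v - ?w\<bar> + \<bar>?w + ?v\<bar> \<le> 2" by auto
    have M0: "?M \<ge> 0" using a(4)[of ?t] by (rule order_trans[rotated]) (simp add: s_def)
    have "Re u * ((1 - cos ?t) * (?v - ?w)) \<le> \<bar>Re u * ((1 - cos ?t) * (?v - ?w))\<bar>" by simp
    also have "\<dots> = c * (1 - cos ?t) * \<bar>?v - ?w\<bar>" by (simp add: c_def abs_mult)
    also have "\<dots> \<le> ?M * \<bar>?v - ?w\<bar>" using a(3) by (intro mult_right_mono) auto
    finally have 1: "Re u * ((1 - cos ?t) * (?v - ?w)) \<le> ?M * \<bar>?v - ?w\<bar>" .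
    have "- (Im u * (sin ?t * (?w + ?v))) \<le> \<bar>Im u * (sin ?t * (?w + ?v))\<bar>" by simp
    also have "\<dots> = s * \<bar>sin ?t\<bar> * \<bar>?w + ?v\<bar>" by (simp add: s_def abs_mult)
    also have "\<dots> \<le> ?M * \<bar>?w + ?v\<bar>" using a(4) by (intro mult_right_mono) auto
    finally have "Re u * ((1 - cos ?t) * (?v - ?w)) - Im u * (sin ?t * (?w + ?v))
        \<le> ?M * (\<bar>?v - ?w\<bar> + \<bar>?w + ?v\<bar>)" using 1 by (simp only: distrib_left)
    also have "\<dots> \<le> ?M * 2" using vw M0 by (rule mult_left_mono)
    finally have "(Re u * ((1 - cos ?t) * (?v - ?w)) - Im u * (sin ?t * (?w + ?v))) / real h
        \<le> ?M * 2 / real h" by (rule divide_right_mono) simp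
    then show "Re u * ((1 - cos ?t) / real h * (?v - ?w)) - Im u * (sin ?t / real h * (?w + ?v))
        \<le> 2 / real h * ?M"
      by (simp only: diff_divide_distrib[of "Re u * _"] times_divide_eq_left times_divide_eq_right
          mult.commute[of 2])
  qed
  also have "\<dots> = 2 * harm H - 2 * a * cos_sum H \<theta>" by (rule sum_one_minus_cos)
  also have "2 * harm H - 2 * a * cos_sum H \<theta> \<le> 2 * harm H + 2 * ln 2 + 2 * (exp 4 + 1) / real H"
  proof -
    let ?B = "ln 2 + (exp 4 + 1) / real H"
    have "0 \<le> \<theta>" "\<theta> \<le> 2 * pi" using assms(2) by (auto simp: \<theta>_def)
    then have "- cos_sum H \<theta> \<le> ?B" using cos_sum_ge[OF assms(1), of \<theta>] by simp
    then have "a * (- cos_sum H \<theta>) \<le> a * ?B" using a(1) by (rule mult_left_mono)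
    also have "\<dots> \<le> ?B"
      using a(1,2) by (intro mult_left_le_one_le add_nonneg_nonneg divide_nonneg_nonneg) auto
    finally have "- (a * cos_sum H \<theta>) \<le> ?B" by simp
    then show ?thesis unfolding mult.assoc times_divide_eq_right[symmetric] by linarith
  qed
  finally show ?thesis by (simp add: z_def)
qed

text \<open>At \<open>\<alpha> = 1/2\<close> all sines vanish, so the sum is real, and the signs
  make each difference \<open>y (-h) - y h\<close> equal to 2.\<close>

lemma cmod_trig_sum_half:
  "2 * harm H - 2 * cos_sum H pi \<le> cmod (trig_sum H (1/2) (\<lambda>h. - of_int (sgn h)))"
proof -
  have "2 * harm H - 2 * cos_sum H pi = (\<Sum>h=1..H. 2 / real h * (1 - 1 * cos (real h * pi)))"
    by (subst sum_one_minus_cos) simp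
  also have "\<dots> = Re (trig_sum H (1/2) (\<lambda>h. - of_int (sgn h)))"
    by (auto simp: trig_sum_eq intro!: sum.cong)
  also have "\<dots> \<le> cmod (trig_sum H (1/2) (\<lambda>h. - of_int (sgn h)))" by (rule complex_Re_le_cmod)
  finally show ?thesis .
qed

section \<open>Harmonic numbers and the final estimate\<close>

lemma harm_approx:
  assumes "H \<ge> 1"
  shows "\<bar>harm H - (ln (real H) + euler_mascheroni)\<bar> \<le> 1 / real H"
proof -
  have "euler_mascheroni \<in> {harm H - ln (real (Suc H)) + inverse (real (2*(H+1)))..
      harm H - ln (real (Suc H)) + inverse (real (2*H))}"
    by (rule euler_mascheroni_bounds[OF assms])
  \<comment> \<open>The library bounds involve \<open>ln (H + 1)\<close>. Replacing it by
    \<open>ln H\<close> shifts the difference by at most \<open>1/H\<close>, in the direction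
    opposite to the first error, so the two do not accumulate.\<close>
  moreover have "ln (real (Suc H)) - ln (real H) \<le> 1 / real H"
  proof -
    have "ln (real (Suc H)) - ln (real H) = ln (real (Suc H) / real H)"
      using assms by (simp add: ln_div)
    also have "\<dots> \<le> real (Suc H) / real H - 1" using assms by (intro ln_le_minus_one) simp
    finally show ?thesis using assms by (simp add: field_simps)
  qed
  moreover have "ln (real H) \<le> ln (real (Suc H))" using assms by simp
  moreover have "inverse (real (2*(H+1))) \<ge> 0" "inverse (real (2*H)) \<le> 1 / real H"
    using assms by (simp_all add: field_simps)
  ultimately show ?thesis unfolding abs_le_iff atLeastAtMost_iff by linarith
qed

theorem theorem2p1:
  "\<exists>C::real. \<forall>H::nat. H \<ge> 1 \<longrightarrow>
     \<bar>G H - (2 * ln (real H) + 2 * ln 2 + 2 * euler_mascheroni)\<bar> \<le> C * (1 / real H)"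
proof (intro exI allI impI)
  fix H :: nat assume H: "H \<ge> 1"
  obtain \<alpha> y where max: "\<alpha> \<in> {0..<1}" "y \<in> idx H \<rightarrow> {-1..1}" "G H = cmod (trig_sum H \<alpha> y)"
    "\<And>\<beta> z. \<beta> \<in> {0..<1} \<Longrightarrow> z \<in> idx H \<rightarrow> {-1..1} \<Longrightarrow> cmod (trig_sum H \<beta> z) \<le> G H"
    using G_is_max by blast
  have "G H \<le> 2 * harm H + 2 * ln 2 + 2 * (exp 4 + 1) / real H"
    using cmod_trig_sum_le[OF H max(1,2)] max(3) by simp
  moreover have "2 * (exp 4 + 1) / real H = 2 * exp 4 * (1 / real H) + 2 * (1 / real H)"
    by (simp add: add_divide_distrib distrib_left)
  moreover have "2 * harm H - 2 * cos_sum H pi \<le> G H"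
    using cmod_trig_sum_half max(4)[of "1/2" "\<lambda>h. - of_int (sgn h)"]
    by (rule order_trans) (auto simp: sgn_if)
  moreover have "0 \<le> exp 4 * (1 / real H)" by simp
  \<comment> \<open>The constant comes from the upper bound: 2 from \<open>harm_approx\<close> and
    \<open>2 * exp 4 + 2\<close> from \<open>cmod_trig_sum_le\<close>. The lower bound needs only
    4.\<close>
  ultimately show "\<bar>G H - (2 * ln (real H) + 2 * ln 2 + 2 * euler_mascheroni)\<bar>
      \<le> (2 * exp 4 + 4) * (1 / real H)"
    using harm_approx[OF H] cos_sum_pi_approx[OF H]
    unfolding abs_le_iff distrib_right by linarith
qed

end
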